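(* Let $(M,N)$ be an amicable pair with $\gcd(M,N)=1$. Then \[ MN<\frac{\pi^2}{6}\,2^{4^K-2\cdot 2^K}, \] where $K=\omega(MN)$.
   Context: $\sigma(n)$ denotes the sum of the positive divisors of $n$ and $\omega(n)$ the number of distinct prime factors of $n$. An amicable pair is a pair $(M,N)$ of distinct positive integers with $\sigma(M)=\sigma(N)=M+N$ (equivalently, each is the sum of the proper divisors of the other). *)

theory Defs
  imports "HOL-Analysis.Analysis" "HOL-Computational_Algebra.Computational_Algebra"
begin

(* Sum of the positive divisors.  At n = 0 the index set is infinite, so the
   value there is the conventional 0; amicable pairs are positive by definition. *)
definition divisor_sum :: "nat \<Rightarrow> nat" where
  "divisor_sum n = (\<Sum>d | d dvd n. d)"

definition num_prime_factors :: "nat \<Rightarrow> nat" where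
  "num_prime_factors n = card (prime_factors n)"

definition amicable_pair :: "nat \<Rightarrow> nat \<Rightarrow> bool" where
  "amicable_pair M N \<longleftrightarrow>
     M > 0 \<and> N > 0 \<and> M \<noteq> N \<and> divisor_sum M = M + N \<and> divisor_sum N = M + N"

end

theory Submission
  imports Defs
begin

text \<open>Dividing \<open>\<sigma>(M) = \<sigma>(N) = M + N\<close> gives \<open>M / \<sigma>(M) + N / \<sigma>(N) = 1\<close>, and both summands are products
  over primes. Replace the factor of each prime by 1, or by \<open>1 - 1/p\<close>, or by its true value
  \<open>p^e / \<sigma>(p^e)\<close>. The excess of such an approximation over 1 is a fraction with denominator at most \<open>D\<close>,
  the product of the denominators used. It vanishes only if all factors are true, because \<open>\<sigma>(M) = M + N\<close> is
  coprime to \<open>M * N\<close>. If it is positive, passing from 1 to \<open>1 - 1/p\<close> at the remaining primes, smallest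
  first, makes it nonpositive; if it is negative, restoring the true values at the primes
  with factor \<open>1 - 1/p\<close> makes it nonnegative. A comparison with Sylvester's sequence shows that the first \<open>r\<close>
  steps, up to the change of sign, raise the bound on \<open>D\<close> to at most its image under the \<open>r\<close>-th iterate
  of \<open>u \<mapsto> u * (u + 1)\<close>. With \<open>K\<close> primes there are \<open>2 * K\<close> steps in all, and they start at \<open>D = 1\<close> and
  end at \<open>D = \<sigma>(M) * \<sigma>(N) = (M + N)^2\<close>. Starting the doubling argument from the second iterate, 6, one obtains
  \<open>M * N < 7 ^ 4 ^ (K - 1)\<close>, which suffices for \<open>K \<ge> 3\<close>; and two prime powers are both deficient, so \<open>K = 2\<close>
  is impossible.\<close>

section \<open>Comparing sums through partial products\<close>

text \<open>Summation by parts. The sign of the full sum is left open: only the shorter partial sums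
  get multiplied by the differences \<open>a i - a (Suc i)\<close>.\<close>

lemma abel_sum_ge:
  fixes a t :: "nat \<Rightarrow> real"
  assumes "\<And>i j. i \<le> j \<Longrightarrow> j \<le> n \<Longrightarrow> a j \<le> a i"
    and "\<And>j. j \<le> n \<Longrightarrow> (\<Sum>i<j. t i) \<ge> 0"
  shows "a n * (\<Sum>i<Suc n. t i) \<le> (\<Sum>i<Suc n. a i * t i)"
  using assms
proof (induction n)
  case 0
  then show ?case by simp
next
  case (Suc n)
  have nonneg: "(\<Sum>i<Suc n. t i) \<ge> 0"
    using Suc.prems(2)[of "Suc n"] by simp
  have "a (Suc n) * (\<Sum>i<Suc n. t i) \<le> a n * (\<Sum>i<Suc n. t i)"
    using Suc.prems(1)[of n "Suc n"] nonneg by (intro mult_right_mono) auto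
  also have "\<dots> \<le> (\<Sum>i<Suc n. a i * t i)"
    using Suc.prems by (intro Suc.IH) auto
  finally show ?case
    by (simp add: distrib_left)
qed

text \<open>With \<open>t i = ln (b i / a i)\<close> the product hypotheses say that the partial
  sums of \<open>t\<close> are nonnegative and the full one is positive. Abel summation with the
  decreasing weights \<open>a\<close> makes the sum of \<open>a i * t i\<close> positive, and
  \<open>ln y <= y - 1\<close> bounds each term by \<open>b i - a i\<close>.\<close>

lemma sum_less_of_prod_le:
  fixes a b :: "nat \<Rightarrow> real"
  assumes pos: "\<And>i. i < n \<Longrightarrow> a i > 0" "\<And>i. i < n \<Longrightarrow> b i > 0"
    and mono: "\<And>i j. i \<le> j \<Longrightarrow> j < n \<Longrightarrow> a j \<le> a i"
    and le: "\<And>j. j \<le> n \<Longrightarrow> (\<Prod>i<j. a i) \<le> (\<Prod>i<j. b i)"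
    and less: "(\<Prod>i<n. a i) < (\<Prod>i<n. b i)"
  shows "(\<Sum>i<n. a i) < (\<Sum>i<n. b i)"
proof -
  obtain m where n: "n = Suc m"
    using less by (cases n) auto
  define t where "t i = ln (b i / a i)" for i
  have T: "(\<Sum>i<j. t i) = ln ((\<Prod>i<j. b i) / (\<Prod>i<j. a i))" if "j \<le> n" for j
  proof -
    have "b i / a i \<noteq> 0" if "i \<in> {..<j}" for i
      using pos[of i] that \<open>j \<le> n\<close> by auto
    then have "ln (\<Prod>i<j. b i / a i) = (\<Sum>i<j. t i)"
      unfolding t_def by (intro ln_prod) auto
    then show ?thesis
      by (simp add: prod_dividef)
  qed
  have pp: "(\<Prod>i<j. a i) > 0" if "j \<le> n" for j
    using pos that by (intro prod_pos) auto
  have "0 < a m * (\<Sum>i<Suc m. t i)"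
    using less pp[of n] pos(1)[of m] T[of n] n by (intro mult_pos_pos) auto
  also have "\<dots> \<le> (\<Sum>i<Suc m. a i * t i)"
    using mono le pp T n by (intro abel_sum_ge) auto
  also have "\<dots> \<le> (\<Sum>i<Suc m. b i - a i)"
  proof (rule sum_mono)
    fix i assume "i \<in> {..<Suc m}"
    then have i: "a i > 0" "b i > 0"
      using pos n by auto
    then have "t i \<le> b i / a i - 1"
      unfolding t_def by (intro ln_le_minus_one) auto
    then have "a i * t i \<le> a i * (b i / a i - 1)"
      using i by (intro mult_left_mono) auto
    then show "a i * t i \<le> b i - a i"
      using i by (simp add: right_diff_distrib)
  qed
  finally show ?thesis
    by (simp add: sum_subtractf n)
qed

section \<open>Sylvester iterates as the extremal case\<close>

text \<open>The iterates from 1 are 1, 2, 6, 42, ...; adding 1 gives Sylvester's sequence 2, 3, 7,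
  43, ....\<close>

definition sylv :: "real \<Rightarrow> real" where
  "sylv u = u * (u + 1)"

lemma sylv_funpow_pos: "u > 0 \<Longrightarrow> (sylv ^^ n) u > 0"
  by (induction n) (auto simp: sylv_def add_pos_pos)

lemma sylv_funpow_mono:
  assumes "0 \<le> u" "u \<le> v"
  shows "0 \<le> (sylv ^^ n) u \<and> (sylv ^^ n) u \<le> (sylv ^^ n) v"
  by (induction n) (use assms in \<open>auto simp: sylv_def intro!: mult_mono\<close>)

text \<open>Since \<open>u * (u + 1) + 1 <= (u + 1)^2\<close>, one step at most squares
  \<open>u + 1\<close>.\<close>

lemma sylv_funpow_le: "u \<ge> 0 \<Longrightarrow> (sylv ^^ n) u + 1 \<le> (u + 1) ^ 2 ^ n"
proof (induction n)
  case (Suc n)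
  let ?v = "(sylv ^^ n) u"
  have v: "?v \<ge> 0"
    using Suc.prems(1) by (induction n) (auto simp: sylv_def)
  have "(sylv ^^ Suc n) u + 1 \<le> (?v + 1)\<^sup>2"
    using v by (simp add: sylv_def power2_eq_square algebra_simps)
  also have "\<dots> \<le> ((u + 1) ^ 2 ^ n)\<^sup>2"
    using Suc v by (intro power_mono) auto
  finally show ?case
    by (simp add: power_mult [symmetric] mult.commute)
qed simp

text \<open>Telescopes because \<open>v + 1 = sylv v / v\<close>. The reciprocals telescope in
  \<open>sylv_sum\<close> because \<open>1 / (v + 1) = 1 / v - 1 / sylv v\<close>.\<close>

lemma sylv_prod:
  assumes "u > 0"
  shows "(\<Prod>i<n. (sylv ^^ (l + i)) u + 1) = (sylv ^^ (l + n)) u / (sylv ^^ l) u"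
proof (induction n)
  case 0
  then show ?case using sylv_funpow_pos[OF assms, of l] by simp
next
  case (Suc n)
  then show ?case by (simp add: sylv_def)
qed

lemma sylv_sum:
  assumes "u > 0"
  shows "(\<Sum>i<n. 1 / ((sylv ^^ (l + i)) u + 1)) = 1 / (sylv ^^ l) u - 1 / (sylv ^^ (l + n)) u"
proof (induction n)
  case (Suc n)
  have "1 / (v + 1) = 1 / v - 1 / sylv v" if "v > 0" for v
    using that by (simp add: sylv_def divide_simps add_pos_pos less_imp_neq[THEN not_sym])
  from this[OF sylv_funpow_pos[OF assms, of "l + n"]] Suc show ?case
    by simp
qed simp

text \<open>Equality in all hypotheses forces \<open>x j = D * (\<Prod>i<j. x i) + 1\<close> (up to the last index),
  so the Sylvester-type sequence is the worst case.\<close>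

lemma prod_le_sylv:
  fixes x :: "nat \<Rightarrow> real"
  assumes D: "D > 0"
    and pos: "\<And>i. i < r \<Longrightarrow> x i > 0"
    and mono: "\<And>i j. i \<le> j \<Longrightarrow> j < r \<Longrightarrow> x i \<le> x j"
    and tail: "\<And>j. j < r \<Longrightarrow> 1 / (D * (\<Prod>i<j. x i)) \<le> (\<Sum>i=j..<r. 1 / x i)"
  shows "D * (\<Prod>i<r. x i) \<le> (sylv ^^ r) D"
proof (rule ccontr)
  assume contra: "\<not> ?thesis"
  let ?u = "\<lambda>i. (sylv ^^ i) D"
  let ?P = "\<lambda>j. \<Prod>i<j. x i"
  \<comment> \<open>The maximum \<open>l\<close> of \<open>A\<close> is the last index at which the
    product has not overtaken the iterate. From there to \<open>r\<close> it stays strictly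
    ahead.\<close>
  define A where "A = {l. l \<le> r \<and> D * ?P l \<le> ?u l}"
  have "0 \<in> A" "finite A"
    by (auto simp: A_def)
  define l where "l = Max A"
  have "l \<in> A"
    unfolding l_def using \<open>0 \<in> A\<close> \<open>finite A\<close> by (intro Max_in) auto
  then have l: "l < r" "D * ?P l \<le> ?u l"
    using contra by (auto simp: A_def le_less)
  have above: "?u j < D * ?P j" if "l < j" "j \<le> r" for j
  proof -
    have "j \<notin> A"
      using that Max_ge[OF \<open>finite A\<close>, of j] unfolding l_def by auto
    then show ?thesis
      using that by (auto simp: A_def)
  qed
  have Ppos: "?P j > 0" if "j \<le> r" for j
    using pos that by (intro prod_pos) auto
  have split: "?P (l + j) = ?P l * (\<Prod>i<j. x (l + i))" for j
    by (induction j) auto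
  define n where "n = r - l"
  have r: "r = l + n"
    using l n_def by auto
  have upos: "?u j > 0" for j
    using sylv_funpow_pos[OF D] .
  \<comment> \<open>From \<open>l\<close> on, the \<open>x\<close> outgrow the Sylvester terms in
    every partial product. Hence the sum of their reciprocals is less than the Sylvester sum, which
    is below \<open>1 / ?u l\<close>, and this contradicts \<open>tail\<close> at
    \<open>l\<close>.\<close>
  have prods: "(\<Prod>i<j. 1 / x (l + i)) < (\<Prod>i<j. 1 / (?u (l + i) + 1))" if "0 < j" "j \<le> n" for j
  proof -
    have "?u (l + j) < D * ?P l * (\<Prod>i<j. x (l + i))"
      using above[of "l + j"] that r by (simp add: split)
    also have "\<dots> \<le> ?u l * (\<Prod>i<j. x (l + i))"
      using l that r pos by (intro mult_right_mono prod_nonneg) (auto intro: less_imp_le)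
    finally have "?u (l + j) / ?u l < (\<Prod>i<j. x (l + i))"
      using upos[of l] by (simp add: field_simps)
    then show ?thesis
      using upos[of "l + j"] upos[of l]
      by (simp add: prod_dividef sylv_prod[OF D] frac_less2 del: divide_divide_eq_right)
  qed
  have "(\<Sum>i<n. 1 / x (l + i)) < (\<Sum>i<n. 1 / (?u (l + i) + 1))"
  proof (rule sum_less_of_prod_le)
    show "(\<Prod>i<j. 1 / x (l + i)) \<le> (\<Prod>i<j. 1 / (?u (l + i) + 1))" if "j \<le> n" for j
      using prods[of j] that by (cases "j = 0") auto
    show "(\<Prod>i<n. 1 / x (l + i)) < (\<Prod>i<n. 1 / (?u (l + i) + 1))"
      using prods[of n] l r by auto
    show "1 / (?u (l + i) + 1) > 0" for i
      using upos[of "l + i"] by simp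
    show "1 / x (l + j) \<le> 1 / x (l + i)" if "i \<le> j" "j < n" for i j
      using that r pos by (intro divide_left_mono mono mult_pos_pos) auto
  qed (use pos r in auto)
  also have "\<dots> < 1 / ?u l"
    using upos[of "l + n"] by (simp add: sylv_sum[OF D])
  also have "\<dots> \<le> 1 / (D * ?P l)"
    using l D Ppos[of l] upos[of l] by (intro divide_left_mono mult_pos_pos) auto
  also have "\<dots> \<le> (\<Sum>i=l..<r. 1 / x i)"
    using tail l by simp
  also have "\<dots> = (\<Sum>i<n. 1 / x (l + i))"
    using sum.shift_bounds_nat_ivl[of "\<lambda>i. 1 / x i" 0 l n] r
    by (simp add: atLeast0LessThan add.commute)
  finally show False
    by simp
qed

text \<open>Take the first \<open>r\<close> with \<open>F r <= 0\<close>. For \<open>j < r\<close>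
  the gap bounds \<open>F j\<close> from below, while \<open>F j <= F j - F r\<close> is at most the
  sum of the remaining \<open>1 / x i\<close>; this is the tail condition of
  \<open>prod_le_sylv\<close>.\<close>

lemma descent_to_sylv:
  fixes x F :: "nat \<Rightarrow> real"
  assumes D: "D > 0"
    and pos: "\<And>i. i < m \<Longrightarrow> x i > 0"
    and mono: "\<And>i j. i \<le> j \<Longrightarrow> j < m \<Longrightarrow> x i \<le> x j"
    and F: "F 0 > 0" "F m \<le> 0"
    and step: "\<And>j. j < m \<Longrightarrow> F j - F (Suc j) \<le> 1 / x j"
    and gap: "\<And>j. j < m \<Longrightarrow> F j > 0 \<Longrightarrow> 1 / (D * (\<Prod>i<j. x i)) \<le> F j"
  obtains r where "0 < r" "r \<le> m" "D * (\<Prod>i<r. x i) \<le> (sylv ^^ r) D"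
proof -
  define r where "r = (LEAST r. F r \<le> 0)"
  have r: "F r \<le> 0" "r \<le> m"
    unfolding r_def using F by (auto intro: LeastI Least_le)
  have below: "F j > 0" if "j < r" for j
    using not_less_Least[of j "\<lambda>r. F r \<le> 0"] that unfolding r_def by auto
  have "D * (\<Prod>i<r. x i) \<le> (sylv ^^ r) D"
  proof (rule prod_le_sylv)
    fix j assume j: "j < r"
    have "1 / (D * (\<Prod>i<j. x i)) \<le> F j - F r"
      using gap[of j] below[OF j] j r by simp
    also have "\<dots> = (\<Sum>i=j..<r. F i - F (Suc i))"
      using sum_Suc_diff'[of j r "\<lambda>i. - F i"] j by (simp add: algebra_simps)
    also have "\<dots> \<le> (\<Sum>i=j..<r. 1 / x i)"
      using step r by (intro sum_mono) auto
    finally show "1 / (D * (\<Prod>i<j. x i)) \<le> (\<Sum>i=j..<r. 1 / x i)" .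
  qed (use D pos mono r in auto)
  moreover have "0 < r"
    using r F by (cases "r = 0") auto
  ultimately show ?thesis
    using that r by blast
qed

section \<open>Divisor sums of products and prime powers\<close>

lemma divisor_sum_coprime_mult:
  assumes "coprime a b"
  shows "divisor_sum (a * b) = divisor_sum a * divisor_sum b"
proof -
  have img: "{d. d dvd a * b} = (\<lambda>(x, y). x * y) ` ({d. d dvd a} \<times> {d. d dvd b})"
  proof (intro equalityI subsetI)
    fix d assume "d \<in> {d. d dvd a * b}"
    then obtain x y where "d = x * y" "x dvd a" "y dvd b"
      by (auto elim: dvd_productE)
    then show "d \<in> (\<lambda>(x, y). x * y) ` ({d. d dvd a} \<times> {d. d dvd b})"
      by auto
  qed (auto intro: mult_dvd_mono)
  have inj: "inj_on (\<lambda>(x, y). x * y) ({d. d dvd a} \<times> {d. d dvd b})"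
  proof -
    have "x dvd x' \<and> y dvd y'"
      if "x dvd a" "x' dvd a" "y dvd b" "y' dvd b" "x * y = x' * y'" for x x' y y'
    proof -
      have "coprime x y'" "coprime y x'"
        using assms that by (auto intro: coprime_divisors simp: coprime_commute)
      then show ?thesis
        using dvd_triv_left[of x y] dvd_triv_right[of y x] unfolding that(5)
        by (simp_all add: coprime_dvd_mult_left_iff coprime_dvd_mult_right_iff)
    qed
    then show ?thesis
      unfolding inj_on_def by (smt (verit) SigmaE case_prod_conv dvd_antisym mem_Collect_eq)
  qed
  show ?thesis
    unfolding divisor_sum_def img
    by (subst sum.reindex[OF inj])
       (simp add: sum_product sum.cartesian_product case_prod_unfold o_def)
qed

lemma divisor_sum_prod_primes:
  assumes "finite A" "\<And>p. p \<in> A \<Longrightarrow> prime p"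
  shows "divisor_sum (\<Prod>p\<in>A. p ^ e p) = (\<Prod>p\<in>A. divisor_sum (p ^ e p))"
  using assms
proof (induction A)
  case empty
  then show ?case by (simp add: divisor_sum_def)
next
  case (insert p A)
  have "coprime (p ^ e p) (\<Prod>q\<in>A. q ^ e q)"
    using insert by (intro prod_coprime_right) (auto intro!: primes_coprime)
  then show ?case
    using insert by (simp add: divisor_sum_coprime_mult)
qed

lemma divisor_sum_prime_power:
  assumes "prime p"
  shows "(p - 1) * divisor_sum (p ^ k) = p ^ Suc k - 1"
proof -
  have "{d. d dvd p ^ k} = (\<lambda>i. p ^ i) ` {..k}"
    using divides_primepow_nat[OF assms] by auto
  moreover have "inj_on (\<lambda>i. p ^ i) {..k}"
    using prime_gt_1_nat[OF assms] by (auto simp: inj_on_def)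
  ultimately have "divisor_sum (p ^ k) = (\<Sum>i\<le>k. p ^ i)"
    by (simp add: divisor_sum_def sum.reindex)
  moreover have "p \<ge> 1"
    using prime_gt_0_nat[OF assms] by simp
  then have "int ((p - 1) * (\<Sum>i\<le>k. p ^ i)) = int (p ^ Suc k - 1)"
    using power_diff_1_eq[of "int p" "Suc k"]
    by (simp add: of_nat_diff lessThan_Suc_atMost one_le_power)
  ultimately show ?thesis
    by (metis of_nat_eq_iff)
qed

section \<open>Descent along subsets of a finite set\<close>

text \<open>Inserting the elements in increasing order of \<open>x\<close> reduces this to
  \<open>descent_to_sylv\<close>; the resulting \<open>B\<close> is a prefix of the sorted
  list.\<close>

lemma subset_descent_to_sylv:
  fixes F :: "'a set \<Rightarrow> real" and x :: "'a \<Rightarrow> real"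
  assumes "finite A" and D: "D > 0"
    and pos: "\<And>q. q \<in> A \<Longrightarrow> x q > 0"
    and F: "F {} > 0" "F A \<le> 0"
    and step: "\<And>B q. B \<subseteq> A \<Longrightarrow> q \<in> A \<Longrightarrow> q \<notin> B \<Longrightarrow> F B - F (insert q B) \<le> 1 / x q"
    and gap: "\<And>B. B \<subseteq> A \<Longrightarrow> F B > 0 \<Longrightarrow> 1 / (D * (\<Prod>q\<in>B. x q)) \<le> F B"
  obtains B where "B \<subseteq> A" "B \<noteq> {}" "D * (\<Prod>q\<in>B. x q) \<le> (sylv ^^ card B) D"
proof -
  obtain xs0 where xs0: "set xs0 = A" "distinct xs0"
    using finite_distinct_list[OF \<open>finite A\<close>] by blast
  define xs where "xs = sort_key x xs0"
  have xs: "set xs = A" "distinct xs" "sorted (map x xs)"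
    using xs0 by (auto simp: xs_def)
  define B where "B j = set (take j xs)" for j
  have sub: "B j \<subseteq> A" for j
    using set_take_subset[of j xs] xs by (simp add: B_def)
  have card: "card (B j) = j" if "j \<le> length xs" for j
    using that xs by (simp add: B_def distinct_card)
  have prod: "(\<Prod>i<j. x (xs ! i)) = (\<Prod>q\<in>B j. x q)" if "j \<le> length xs" for j
  proof -
    have "B j = (\<lambda>i. xs ! i) ` {..<j}"
      using nth_image[OF that] by (simp add: B_def lessThan_atLeast0)
    moreover have "inj_on (\<lambda>i. xs ! i) {..<j}"
      using that xs(2) by (auto simp: inj_on_def nth_eq_iff_index_eq)
    ultimately show ?thesis
      by (simp add: prod.reindex)
  qed
  have Suc: "B (Suc j) = insert (xs ! j) (B j)" "xs ! j \<notin> B j" if "j < length xs" for j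
  proof -
    show B: "B (Suc j) = insert (xs ! j) (B j)"
      using that by (simp add: B_def take_Suc_conv_app_nth)
    show "xs ! j \<notin> B j"
      using card[of j] card[of "Suc j"] that B by (auto simp: insert_absorb)
  qed
  obtain r where r: "0 < r" "r \<le> length xs" "D * (\<Prod>i<r. x (xs ! i)) \<le> (sylv ^^ r) D"
  proof (rule descent_to_sylv[of D "length xs" "\<lambda>i. x (xs ! i)" "\<lambda>j. F (B j)"])
    show "x (xs ! i) \<le> x (xs ! j)" if "i \<le> j" "j < length xs" for i j
      using sorted_nth_mono[OF xs(3), of i j] that by simp
    show "F (B j) - F (B (Suc j)) \<le> 1 / x (xs ! j)" if "j < length xs" for j
      using step[OF sub, of "xs ! j" j] Suc[OF that] that xs by auto
  qed (use D pos F gap sub prod xs in \<open>auto simp: B_def\<close>)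
  show ?thesis
    using that[of "B r"] r sub card[of r] prod[of r] by fastforce
qed

section \<open>Approximations to \<open>M / \<sigma>(M) + N / \<sigma>(N)\<close>\<close>

locale coprime_amicable_pair =
  fixes M N :: nat
  assumes amicable: "amicable_pair M N" and cop: "coprime M N"
begin

abbreviation P :: "nat set" where
  "P \<equiv> prime_factors M \<union> prime_factors N"

text \<open>Taken in the product so that one function serves the primes of both numbers; by
  coprimality it agrees with the exponent in \<open>M\<close> or in \<open>N\<close>.\<close>

definition e :: "nat \<Rightarrow> nat" where
  "e p = multiplicity p (M * N)"

definition sig :: "nat \<Rightarrow> nat" where
  "sig p = divisor_sum (p ^ e p)"

text \<open>Level \<open>i\<close> of the prime \<open>p\<close> measures how much of it is taken into account:
  its factor in \<open>M / \<sigma>(M)\<close> or \<open>N / \<sigma>(N)\<close> is replaced by 1 at level 0,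
  by the infinite-exponent limit \<open>1 - 1/p\<close> at level 1, and kept at level 2.\<close>

definition num :: "nat \<Rightarrow> nat \<Rightarrow> nat" where
  "num p i = (if i = 0 then 1 else if i = 1 then p - 1 else p ^ e p)"

definition den :: "nat \<Rightarrow> nat \<Rightarrow> nat" where
  "den p i = (if i = 0 then 1 else if i = 1 then p else sig p)"

definition c :: "nat \<Rightarrow> nat \<Rightarrow> real" where
  "c p i = real (num p i) / real (den p i)"

definition E :: "(nat \<Rightarrow> nat) \<Rightarrow> real" where
  "E s = (\<Prod>p\<in>prime_factors M. c p (s p)) + (\<Prod>p\<in>prime_factors N. c p (s p)) - 1"

text \<open>A common denominator of the two products in \<open>E s\<close>, so that
  \<open>E s * D s\<close> is an integer.\<close>

definition D :: "(nat \<Rightarrow> nat) \<Rightarrow> nat" where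
  "D s = (\<Prod>p\<in>P. den p (s p))"

lemma pos: "M > 0" "N > 0" and sigma: "divisor_sum M = M + N" "divisor_sum N = M + N"
  using amicable by (auto simp: amicable_pair_def)

lemma disjoint: "prime_factors M \<inter> prime_factors N = {}"
  using cop by (auto dest: coprime_common_divisor not_prime_unit in_prime_factors_imp_prime)

lemma prime_P: "p \<in> P \<Longrightarrow> prime p"
  by auto

lemma e_left: "p \<in> prime_factors M \<Longrightarrow> e p = multiplicity p M"
  and e_right: "p \<in> prime_factors N \<Longrightarrow> e p = multiplicity p N"
proof -
  have mult: "e p = multiplicity p M + multiplicity p N" if "prime p" for p
    unfolding e_def using that pos by (intro prime_elem_multiplicity_mult_distrib) auto
  show "e p = multiplicity p M" if "p \<in> prime_factors M"
  proof -
    have "\<not> p dvd N"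
      using that disjoint pos by (auto simp: in_prime_factors_iff)
    then show ?thesis
      using mult[of p] that by (simp add: in_prime_factors_iff not_dvd_imp_multiplicity_0)
  qed
  show "e p = multiplicity p N" if "p \<in> prime_factors N"
  proof -
    have "\<not> p dvd M"
      using that disjoint pos by (auto simp: in_prime_factors_iff)
    then show ?thesis
      using mult[of p] that by (simp add: in_prime_factors_iff not_dvd_imp_multiplicity_0)
  qed
qed

lemma e_pos: "p \<in> P \<Longrightarrow> e p > 0"
  using pos by (auto simp: e_left e_right prime_factors_multiplicity)

lemma prod_pow: "(\<Prod>p\<in>prime_factors M. p ^ e p) = M" "(\<Prod>p\<in>prime_factors N. p ^ e p) = N"
  using pos by (simp_all add: e_left e_right prime_factorization_nat[symmetric] cong: prod.cong)

lemma prod_sig: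
  "(\<Prod>p\<in>prime_factors M. sig p) = M + N" "(\<Prod>p\<in>prime_factors N. sig p) = M + N"
  unfolding sig_def
  using divisor_sum_prod_primes[of "prime_factors M" e] divisor_sum_prod_primes[of "prime_factors N" e]
  by (simp_all add: prod_pow sigma in_prime_factors_imp_prime)

text \<open>Each \<open>sig p\<close> divides \<open>M + N\<close>, and a prime dividing
  \<open>M + N\<close> and one of \<open>M\<close>, \<open>N\<close> would divide both.\<close>

lemma not_dvd_sig:
  assumes "p \<in> P" "q \<in> P"
  shows "\<not> q dvd sig p"
proof
  assume "q dvd sig p"
  moreover have "sig p dvd M + N"
    using assms(1) prod_sig dvd_prodI[of "prime_factors M" p sig] dvd_prodI[of "prime_factors N" p sig]
    by auto
  ultimately have "q dvd M + N"
    by (rule dvd_trans)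
  then have "q dvd M \<and> q dvd N"
    using assms(2) by (auto simp: dvd_add_right_iff dvd_add_left_iff)
  then have "is_unit q"
    using cop coprime_common_divisor by blast
  with prime_P[OF assms(2)] show False
    by simp
qed

text \<open>The geometric sum gives \<open>p * p ^ e p - (p - 1) * sig p = 1\<close>, so the factors
  at levels 2 and 1 differ by a unit fraction.\<close>

lemma P_bounds:
  assumes "p \<in> P"
  shows "p > 1" "sig p > 0" "c p (Suc 0) = 1 - 1 / real p"
    and "c p 2 - c p (Suc 0) = 1 / (real p * real (sig p))" and "c p 2 < 1"
proof -
  show p: "p > 1"
    using prime_P[OF assms] by (rule prime_gt_1_nat)
  have sigp: "(p - 1) * sig p = p ^ Suc (e p) - 1"
    unfolding sig_def using prime_P[OF assms] by (rule divisor_sum_prime_power)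
  have gt: "p ^ e p > 1"
    using p e_pos[OF assms] by (intro one_less_power)
  have "real ((p - 1) * sig p) = real (p ^ Suc (e p) - 1)"
    using sigp by simp
  moreover have "p ^ Suc (e p) \<ge> 1"
    using p by (simp add: one_le_power)
  ultimately have sigp': "(real p - 1) * real (sig p) = real p * real p ^ e p - 1"
    using p by (simp add: of_nat_diff)
  show sig: "sig p > 0"
    using not_dvd_sig[OF assms assms] by (cases "sig p = 0") auto
  show c1: "c p (Suc 0) = 1 - 1 / real p"
    using p by (simp add: c_def num_def den_def field_simps of_nat_diff)
  show "c p 2 - c p (Suc 0) = 1 / (real p * real (sig p))"
    unfolding c1 using sigp' p sig by (simp add: c_def num_def den_def field_simps)
  have "(real p - 1) * real p ^ e p < (real p - 1) * real (sig p)"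
    using gt unfolding sigp' by (simp add: algebra_simps flip: of_nat_power)
  then have "real p ^ e p < real (sig p)"
    using p by (simp add: mult_less_cancel_left_pos)
  then show "c p 2 < 1"
    by (simp add: c_def num_def den_def)
qed

lemma den_pos: "p \<in> P \<Longrightarrow> den p i > 0"
  using P_bounds[of p] by (auto simp: den_def)

lemma c_0: "c p 0 = 1"
  by (simp add: c_def num_def den_def)

lemma c_ge_2: "i \<ge> 2 \<Longrightarrow> c p i = c p 2"
  by (simp add: c_def num_def den_def)

lemma c_nonneg: "c p i \<ge> 0"
  by (simp add: c_def)

text \<open>Level 1 undershoots the true factor and level 0 overshoots it. The bound
  \<open>1 / 2\<close> yields positivity and, in \<open>card_P_ge_3\<close>, the deficiency of prime
  powers.\<close>

lemma c_less:
  assumes "p \<in> P"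
  shows "c p (Suc 0) < c p 2" "c p 2 < c p 0" "c p (Suc 0) \<ge> 1 / 2"
proof -
  have "1 / (real p * real (sig p)) > 0" "1 / real p \<le> 1 / 2"
    using P_bounds(1,2)[OF assms] by (auto intro!: divide_left_mono)
  with P_bounds(3-5)[OF assms]
  show "c p (Suc 0) < c p 2" "c p 2 < c p 0" "c p (Suc 0) \<ge> 1 / 2"
    unfolding c_0 by linarith+
qed

lemma c_le_1: "p \<in> P \<Longrightarrow> c p i \<le> 1"
  using c_less[of p] c_0[of p] c_ge_2[of i p] by (cases "i = 0 \<or> i = 1") auto

text \<open>At level 2 everywhere, the two products are \<open>M / \<sigma>(M)\<close> and \<open>N / \<sigma>(N)\<close>, which add up to 1.\<close>

lemma E_full: "(\<And>p. p \<in> P \<Longrightarrow> s p = 2) \<Longrightarrow> E s = 0"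
  using pos by (simp add: E_def c_def num_def den_def prod_dividef prod_sig prod_pow
      flip: of_nat_power of_nat_prod add_divide_distrib of_nat_add)

lemma E_mono:
  assumes "\<And>p. p \<in> P \<Longrightarrow> c p (s p) \<le> c p (t p)"
  shows "E s \<le> E t"
  unfolding E_def using assms
  by (intro diff_right_mono add_mono prod_mono) (auto simp: c_nonneg)

text \<open>Only one of the two products contains \<open>q\<close>, and its remaining factors
  multiply to a number between 0 and 1.\<close>

lemma E_upd:
  assumes "q \<in> P"
  shows "\<bar>E s - E (s(q := j))\<bar> \<le> \<bar>c q (s q) - c q j\<bar>"
proof -
  have split: "(\<Prod>p\<in>X. c p ((s(q := j)) p)) = c q j * (\<Prod>p\<in>X - {q}. c p (s p))"
    "(\<Prod>p\<in>X. c p (s p)) = c q (s q) * (\<Prod>p\<in>X - {q}. c p (s p))"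
    if "q \<in> X" "finite X" for X
    using that by (simp_all add: prod.remove[of X q])
  have bound: "\<bar>a * u - b * u\<bar> \<le> \<bar>a - b\<bar>" if "0 \<le> u" "u \<le> 1" for a b u :: real
    using that mult_left_mono[of u 1 "\<bar>a - b\<bar>"] by (simp add: abs_mult flip: left_diff_distrib)
  have u: "0 \<le> (\<Prod>p\<in>X - {q}. c p (s p))" "(\<Prod>p\<in>X - {q}. c p (s p)) \<le> 1"
    if "X \<subseteq> P" for X
    using that by (auto intro!: prod_nonneg prod_le_1 simp: c_nonneg c_le_1)
  have other: "(\<Prod>p\<in>X. c p ((s(q := j)) p)) = (\<Prod>p\<in>X. c p (s p))" if "q \<notin> X" for X
    using that by (intro prod.cong) auto
  show ?thesis
  proof (cases "q \<in> prime_factors M")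
    case True
    then have "q \<notin> prime_factors N"
      using disjoint by auto
    then show ?thesis
      using split[OF True] other[of "prime_factors N"] bound[OF u, of "prime_factors M"]
      by (simp add: E_def del: fun_upd_apply)
  next
    case False
    then have "q \<in> prime_factors N"
      using assms by auto
    then show ?thesis
      using split[of "prime_factors N"] other[OF False] bound[OF u, of "prime_factors N"]
      by (simp add: E_def del: fun_upd_apply)
  qed
qed

lemma D_split: "D s = (\<Prod>p\<in>prime_factors M. den p (s p)) * (\<Prod>p\<in>prime_factors N. den p (s p))"
  unfolding D_def using disjoint by (intro prod.union_disjoint) auto

lemma D_pos: "D s > 0"
  unfolding D_def using den_pos by (intro prod_pos) auto

lemma E_times_D:
  "E s * real (D s) =
     real ((\<Prod>p\<in>prime_factors M. num p (s p)) * (\<Prod>p\<in>prime_factors N. den p (s p))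
         + (\<Prod>p\<in>prime_factors N. num p (s p)) * (\<Prod>p\<in>prime_factors M. den p (s p)))
     - real (D s)"
proof -
  have "(\<Prod>p\<in>prime_factors M. den p (s p)) > 0" "(\<Prod>p\<in>prime_factors N. den p (s p)) > 0"
    using den_pos by (auto intro!: prod_pos)
  then show ?thesis
    unfolding E_def D_split c_def prod_dividef of_nat_prod [symmetric]
    by (simp add: field_simps del: of_nat_prod)
qed

text \<open>The integer \<open>E s * D s\<close> is nonzero, hence at least 1 in absolute
  value.\<close>

lemma E_gap:
  assumes "E s \<noteq> 0"
  shows "1 / real (D s) \<le> \<bar>E s\<bar>"
proof -
  obtain k :: int where k: "E s * real (D s) = real_of_int k"
    unfolding E_times_D by (metis of_int_diff of_int_of_nat_eq)
  with assms D_pos[of s] have "k \<noteq> 0"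
    by auto
  then have "\<bar>E s * real (D s)\<bar> \<ge> 1"
    unfolding k by linarith
  then show ?thesis
    using D_pos[of s] by (simp add: abs_mult field_simps)
qed

text \<open>The largest prime at level 1 would divide a denominator without dividing the numerator.\<close>

lemma no_level_1:
  assumes XY: "X \<subseteq> P" "Y \<subseteq> P" "X \<inter> Y = {}" and s: "\<And>p. p \<in> P \<Longrightarrow> s p \<le> 2"
    and eq: "(\<Prod>p\<in>X. num p (s p)) * (\<Prod>p\<in>Y. den p (s p))
           + (\<Prod>p\<in>Y. num p (s p)) * (\<Prod>p\<in>X. den p (s p))
           = (\<Prod>p\<in>X. den p (s p)) * (\<Prod>p\<in>Y. den p (s p))"
    and "p \<in> X"
  shows "s p \<noteq> 1"
proof
  assume "s p = 1"
  have "finite X" "finite Y"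
    using finite_subset[OF XY(1)] finite_subset[OF XY(2)] by simp_all
  define L where "L = {p \<in> X. s p = 1}"
  have L: "finite L" "L \<noteq> {}"
    using \<open>finite X\<close> \<open>p \<in> X\<close> \<open>s p = 1\<close> by (auto simp: L_def)
  define q where "q = Max L"
  have q: "q \<in> X" "s q = 1" and max: "\<And>p. p \<in> X \<Longrightarrow> s p = 1 \<Longrightarrow> p \<le> q"
    using Max_in[OF L] Max_ge[OF L(1)] by (auto simp: q_def L_def)
  then have "q \<in> P" "prime q"
    using XY prime_P by auto
  have "q dvd (\<Prod>p\<in>X. den p (s p))"
    using q \<open>finite X\<close> dvd_prodI[of X q "\<lambda>p. den p (s p)"] by (simp add: den_def)
  then have "q dvd (\<Prod>p\<in>Y. num p (s p)) * (\<Prod>p\<in>X. den p (s p))"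
    and "q dvd (\<Prod>p\<in>X. den p (s p)) * (\<Prod>p\<in>Y. den p (s p))"
    by (rule dvd_mult, rule dvd_mult2)
  then have "q dvd (\<Prod>p\<in>X. num p (s p)) * (\<Prod>p\<in>Y. den p (s p))"
    unfolding eq [symmetric] by (simp only: dvd_add_left_iff)
  then have "q dvd (\<Prod>p\<in>X. num p (s p)) \<or> q dvd (\<Prod>p\<in>Y. den p (s p))"
    using \<open>prime q\<close> by (simp only: prime_dvd_mult_iff)
  then have "(\<exists>r\<in>X. q dvd num r (s r)) \<or> (\<exists>r\<in>Y. q dvd den r (s r))"
    using \<open>prime q\<close> \<open>finite X\<close> \<open>finite Y\<close> by (simp only: prime_dvd_prod_iff)
  \<comment> \<open>Neither is possible. A numerator over \<open>X\<close> is 1, or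
    \<open>r - 1\<close> with \<open>0 < r - 1 < q\<close> by maximality, or a power of some
    \<open>r\<close> other than \<open>q\<close>, as \<open>q\<close> has level 1. A denominator
    over \<open>Y\<close> is 1, a prime other than \<open>q\<close>, or some
    \<open>sig r\<close>.\<close>
  then consider r where "r \<in> X" "q dvd num r (s r)" | r where "r \<in> Y" "q dvd den r (s r)"
    by blast
  then show False
  proof cases
    case (1 r)
    then have r: "r \<in> P" "prime r"
      using XY prime_P by auto
    from s[OF r(1)] consider "s r = 0" | "s r = 1" | "s r = 2"
      by linarith
    then show False
    proof cases
      case 1
      then show False
        using \<open>q dvd num r (s r)\<close> \<open>prime q\<close> by (simp add: num_def)
    next
      case 2
      have "r \<le> q" "r > 1"
        using max \<open>r \<in> X\<close> 2 r prime_gt_1_nat by auto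
      then show False
        using \<open>q dvd num r (s r)\<close> 2 by (auto simp: num_def dest!: dvd_imp_le)
    next
      case 3
      then have "q dvd r"
        using \<open>q dvd num r (s r)\<close> \<open>prime q\<close> by (auto simp: num_def dest: prime_dvd_power)
      then have "q = r"
        using \<open>prime q\<close> r by (simp add: primes_dvd_imp_eq)
      then show False
        using 3 q by simp
    qed
  next
    case (2 r)
    then have r: "r \<in> P" "prime r" "q \<noteq> r"
      using XY prime_P q by auto
    then have "\<not> q dvd r"
      using \<open>prime q\<close> primes_dvd_imp_eq by blast
    then show False
      using 2 not_dvd_sig[OF r(1) \<open>q \<in> P\<close>] \<open>prime q\<close> by (auto simp: den_def split: if_splits)
  qed
qed

text \<open>By \<open>no_level_1\<close> only levels 0 and 2 remain, and a single prime at level 0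
  pushes \<open>E s\<close> strictly above its value 0 at full level.\<close>

lemma E_eq_0_imp_full:
  assumes s: "\<And>p. p \<in> P \<Longrightarrow> s p \<le> 2" and "E s = 0" and "p \<in> P"
  shows "s p = 2"
proof -
  have eq: "(\<Prod>p\<in>prime_factors M. num p (s p)) * (\<Prod>p\<in>prime_factors N. den p (s p))
         + (\<Prod>p\<in>prime_factors N. num p (s p)) * (\<Prod>p\<in>prime_factors M. den p (s p)) = D s"
    using E_times_D[of s] \<open>E s = 0\<close> by (simp del: of_nat_add of_nat_mult of_nat_prod)
  have "s p \<noteq> 1" if "p \<in> P" for p
  proof (cases "p \<in> prime_factors M")
    case True
    show ?thesis
      by (rule no_level_1[of "prime_factors M" "prime_factors N"])
         (use True s disjoint eq in \<open>auto simp: D_split\<close>)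
  next
    case False
    show ?thesis
      by (rule no_level_1[of "prime_factors N" "prime_factors M"])
         (use False that s disjoint eq in \<open>auto simp: D_split algebra_simps\<close>)
  qed
  with s have s02: "s p = 0 \<or> s p = 2" if "p \<in> P" for p
    using that by (metis One_nat_def le_Suc_eq le_zero_eq numeral_2_eq_2)
  show ?thesis
  proof (rule ccontr)
    assume "s p \<noteq> 2"
    with s02 \<open>p \<in> P\<close> have "s p = 0"
      by auto
    have pos: "c r i > 0" if "r \<in> P" for r i
      using c_less[OF that] c_0[of r] c_ge_2[of i r] by (cases "i = 0 \<or> i = 1") auto
    have le: "c r 2 \<le> c r (s r)" if "r \<in> P" for r
      using s02[OF that] c_less[OF that] by auto
    have lt: "(\<Prod>r\<in>X. c r 2) < (\<Prod>r\<in>X. c r (s r))" if "X \<subseteq> P" "p \<in> X" for X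
    proof -
      have "finite X"
        using that(1) by (rule finite_subset) simp
      have "c p 2 * (\<Prod>r\<in>X - {p}. c r 2) < c p (s p) * (\<Prod>r\<in>X - {p}. c r (s r))"
      proof (rule mult_less_le_imp_less)
        show "c p 2 < c p (s p)"
          using c_less[OF \<open>p \<in> P\<close>] \<open>s p = 0\<close> by simp
        show "(\<Prod>r\<in>X - {p}. c r 2) \<le> (\<Prod>r\<in>X - {p}. c r (s r))"
          using le that c_nonneg by (intro prod_mono) blast
        show "(\<Prod>r\<in>X - {p}. c r 2) > 0"
          using pos that by (intro prod_pos) blast
      qed (rule c_nonneg)
      then show ?thesis
        using \<open>finite X\<close> that by (simp add: prod.remove[of X p])
    qed
    have weak: "(\<Prod>r\<in>X. c r 2) \<le> (\<Prod>r\<in>X. c r (s r))" if "X \<subseteq> P" for X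
      using le that c_nonneg by (intro prod_mono) blast
    have "E (\<lambda>_. 2) < E s"
    proof (cases "p \<in> prime_factors M")
      case True
      then show ?thesis
        using lt[of "prime_factors M"] weak[of "prime_factors N"] by (simp add: E_def)
    next
      case False
      then show ?thesis
        using lt[of "prime_factors N"] weak[of "prime_factors M"] \<open>p \<in> P\<close> by (simp add: E_def)
    qed
    then show False
      using E_full[of "\<lambda>_. 2"] \<open>E s = 0\<close> by simp
  qed
qed

section \<open>Raising levels until the excess vanishes\<close>

text \<open>The invariant of the ascent: every level gained costs at most one application of \<open>sylv\<close>.\<close>

definition good :: "(nat \<Rightarrow> nat) \<Rightarrow> bool" where
  "good s \<longleftrightarrow> (\<forall>p\<in>P. s p \<le> 2) \<and> real (D s) \<le> (sylv ^^ (\<Sum>p\<in>P. s p)) 1"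

text \<open>The sign \<open>eps\<close> treats both directions at once. The weight
  \<open>x p\<close> controls the change of \<open>E\<close> and the growth of \<open>D\<close> when
  \<open>p\<close> moves up one level, so the descent applies to \<open>eps * E\<close> as a
  function of the set of raised primes. It raises \<open>card B\<close> levels at the cost of
  \<open>card B\<close> applications of \<open>sylv\<close>.\<close>

lemma advance:
  fixes x :: "nat \<Rightarrow> real"
  defines "raise \<equiv> \<lambda>s i B p. if p \<in> B then Suc i else s p"
  assumes "good s" and A: "A = {p \<in> P. s p = i}" and "i < 2" and eps: "\<bar>eps\<bar> = 1"
    and x: "\<And>p. p \<in> A \<Longrightarrow> x p > 0"
    and c: "\<And>p. p \<in> A \<Longrightarrow> \<bar>c p i - c p (Suc i)\<bar> \<le> 1 / x p"
    and den: "\<And>p. p \<in> A \<Longrightarrow> real (den p (Suc i)) \<le> real (den p i) * x p"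
    and E: "eps * E s > 0" "eps * E (raise s i A) \<le> 0"
  shows "\<exists>s'. good s' \<and> (\<Sum>p\<in>P. s p) < (\<Sum>p\<in>P. s' p)"
proof -
  have D_raise: "real (D (raise s i B)) \<le> real (D s) * (\<Prod>p\<in>B. x p)" if "B \<subseteq> A" for B
  proof -
    have "real (D (raise s i B)) \<le> (\<Prod>p\<in>P. real (den p (s p)) * (if p \<in> B then x p else 1))"
      unfolding D_def of_nat_prod using that den A by (intro prod_mono) (auto simp: raise_def)
    also have "\<dots> = real (D s) * (\<Prod>p\<in>P. if p \<in> B then x p else 1)"
      by (simp add: D_def prod.distrib)
    also have "(\<Prod>p\<in>P. if p \<in> B then x p else 1) = (\<Prod>p\<in>P \<inter> B. x p)"
      by (rule prod.inter_restrict [symmetric]) simp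
    also have "P \<inter> B = B"
      using that A by auto
    finally show ?thesis .
  qed
  obtain B where B: "B \<subseteq> A" "B \<noteq> {}"
    "real (D s) * (\<Prod>p\<in>B. x p) \<le> (sylv ^^ card B) (real (D s))"
  proof (rule subset_descent_to_sylv[of A "real (D s)" x "\<lambda>B. eps * E (raise s i B)"])
    show "eps * E (raise s i B) - eps * E (raise s i (insert q B)) \<le> 1 / x q"
      if "B \<subseteq> A" "q \<in> A" "q \<notin> B" for B q
    proof -
      have "raise s i (insert q B) = (raise s i B)(q := Suc i)" "raise s i B q = i" "q \<in> P"
        using that A by (auto simp: raise_def)
      then have "\<bar>E (raise s i B) - E (raise s i (insert q B))\<bar> \<le> 1 / x q"
        using E_upd[of q "raise s i B" "Suc i"] c[OF that(2)] by simp
      moreover have "eps * a - eps * b \<le> \<bar>a - b\<bar>" for a b :: real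
        using eps by (auto simp: abs_if split: if_splits)
      ultimately show ?thesis
        by (meson order_trans)
    qed
    show "1 / (real (D s) * (\<Prod>p\<in>B. x p)) \<le> eps * E (raise s i B)"
      if "B \<subseteq> A" "eps * E (raise s i B) > 0" for B
    proof -
      have "1 / (real (D s) * (\<Prod>p\<in>B. x p)) \<le> 1 / real (D (raise s i B))"
        using D_raise[OF that(1)] D_pos that(1) x
        by (intro divide_left_mono mult_pos_pos prod_pos) auto
      also have "\<dots> \<le> \<bar>E (raise s i B)\<bar>"
        using that(2) by (intro E_gap) auto
      also have "\<dots> = \<bar>eps * E (raise s i B)\<bar>"
        using eps by (simp add: abs_mult)
      finally show ?thesis
        using that(2) by simp
    qed
  qed (use A x E D_pos in \<open>auto simp: raise_def\<close>)
  have "finite B" "B \<subseteq> P"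
    using B A by (auto intro: finite_subset[of _ P])
  have "(\<Sum>p\<in>P. raise s i B p) = (\<Sum>p\<in>P. s p + (if p \<in> B then 1 else 0))"
    using B A by (intro sum.cong) (auto simp: raise_def)
  also have "\<dots> = (\<Sum>p\<in>P. s p) + card (P \<inter> B)"
    by (simp add: sum.distrib sum.inter_restrict [symmetric])
  also have "P \<inter> B = B"
    using \<open>B \<subseteq> P\<close> by auto
  finally have sum: "(\<Sum>p\<in>P. raise s i B p) = (\<Sum>p\<in>P. s p) + card B" .
  have "real (D (raise s i B)) \<le> (sylv ^^ card B) (real (D s))"
    using D_raise[OF B(1)] B(3) by linarith
  also have "\<dots> \<le> (sylv ^^ card B) ((sylv ^^ (\<Sum>p\<in>P. s p)) 1)"
    using \<open>good s\<close> sylv_funpow_mono[of "real (D s)"] by (simp add: good_def)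
  also have "\<dots> = (sylv ^^ (\<Sum>p\<in>P. raise s i B p)) 1"
    unfolding sum by (simp add: funpow_add add.commute)
  finally have "good (raise s i B)"
    using \<open>good s\<close> \<open>i < 2\<close> by (auto simp: good_def raise_def)
  moreover have "card B > 0"
    using \<open>finite B\<close> B by (simp add: card_gt_0_iff)
  ultimately show ?thesis
    using sum by (intro exI[of _ "raise s i B"]) auto
qed

lemma good_advance:
  assumes "good s" "E s \<noteq> 0"
  shows "\<exists>s'. good s' \<and> (\<Sum>p\<in>P. s p) < (\<Sum>p\<in>P. s' p)"
proof -
  have s: "s p \<le> 2" if "p \<in> P" for p
    using assms that by (auto simp: good_def)
  show ?thesis
  proof (cases "E s > 0")
    case True
    \<comment> \<open>Positive excess: raise level 0 to 1 with weight \<open>p\<close>. Then every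
      factor is at most the true one, so the excess is at most 0.\<close>
    show ?thesis
    proof (rule advance[OF \<open>good s\<close> refl, of 0 1 real])
      have "E (\<lambda>p. if p \<in> {p \<in> P. s p = 0} then Suc 0 else s p) \<le> E (\<lambda>_. 2)"
      proof (rule E_mono)
        fix p assume p: "p \<in> P"
        then have "s p = 0 \<or> s p = 1 \<or> s p = 2"
          using s[of p] by linarith
        then show "c p (if p \<in> {p \<in> P. s p = 0} then Suc 0 else s p) \<le> c p 2"
          using p c_less[OF p] by auto
      qed
      then show "1 * E (\<lambda>p. if p \<in> {p \<in> P. s p = 0} then Suc 0 else s p) \<le> 0"
        using E_full[of "\<lambda>_. 2"] by simp
    qed (use True P_bounds prime_P in \<open>auto simp: c_0 den_def intro: prime_gt_0_nat\<close>)
  next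
    case False
    \<comment> \<open>Negative excess: raise level 1 to 2 with weight \<open>p * sig p\<close>, the
      reciprocal of the change in the factor. Then every factor is at least the true one.\<close>
    show ?thesis
    proof (rule advance[OF \<open>good s\<close> refl, of 1 "-1" "\<lambda>p. real p * real (sig p)"])
      have "E (\<lambda>_. 2) \<le> E (\<lambda>p. if p \<in> {p \<in> P. s p = 1} then Suc 1 else s p)"
      proof (rule E_mono)
        fix p assume p: "p \<in> P"
        then have "s p = 0 \<or> s p = 1 \<or> s p = 2"
          using s[of p] by linarith
        then show "c p 2 \<le> c p (if p \<in> {p \<in> P. s p = 1} then Suc 1 else s p)"
          using p c_less[OF p] by (auto simp: numeral_2_eq_2)
      qed
      then show "-1 * E (\<lambda>p. if p \<in> {p \<in> P. s p = 1} then Suc 1 else s p) \<le> 0"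
        using E_full[of "\<lambda>_. 2"] by simp
      show "\<bar>c p 1 - c p (Suc 1)\<bar> \<le> 1 / (real p * real (sig p))" if "p \<in> {p \<in> P. s p = 1}" for p
        using that P_bounds(4)[of p] c_less[of p] by (simp add: numeral_2_eq_2)
      show "real (den p (Suc 1)) \<le> real (den p 1) * (real p * real (sig p))"
        if "p \<in> {p \<in> P. s p = 1}" for p
      proof -
        have "1 * real (sig p) \<le> (real p * real p) * real (sig p)"
          using that P_bounds(1)[of p] mult_mono[of 1 "real p" 1 "real p"]
          by (intro mult_right_mono) auto
        then show ?thesis
          by (simp add: den_def mult.assoc)
      qed
      show "real p * real (sig p) > 0" if "p \<in> {p \<in> P. s p = 1}" for p
        using that P_bounds(1,2)[of p] by simp
    qed (use False assms in auto)
  qed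
qed

text \<open>The total level is bounded, so a good \<open>s\<close> of maximal total level exists. By
  \<open>good_advance\<close> its excess is 0, which forces level 2 everywhere.\<close>

lemma square_sum_le: "real ((M + N)\<^sup>2) \<le> (sylv ^^ (2 * card P)) 1"
proof -
  have "good (\<lambda>_. 0)"
    by (simp add: good_def D_def den_def)
  moreover have bound: "(\<Sum>p\<in>P. s p) \<le> 2 * card P" if "good s" for s
    using sum_bounded_above[of P s 2] that by (simp add: good_def mult.commute)
  ultimately obtain s where s: "good s" and max: "\<And>t. good t \<Longrightarrow> (\<Sum>p\<in>P. t p) \<le> (\<Sum>p\<in>P. s p)"
    using ex_has_greatest_nat[of good "\<lambda>_. 0" "\<lambda>s. \<Sum>p\<in>P. s p" "Suc (2 * card P)"]
    by (auto simp: less_Suc_eq_le)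
  have "E s = 0"
    using good_advance[OF s] max by (force simp: not_less)
  then have full: "s p = 2" if "p \<in> P" for p
    using E_eq_0_imp_full[of s p] s that by (auto simp: good_def)
  have "D s = (M + N)\<^sup>2"
    unfolding D_split using full by (simp add: den_def prod_sig power2_eq_square)
  moreover have "(\<Sum>p\<in>P. s p) = 2 * card P"
    using full by simp
  ultimately show ?thesis
    using s by (auto simp: good_def)
qed

section \<open>Small cases and the numerical estimate\<close>

lemma card_P_ge_3: "card P \<ge> 3"
proof -
  \<comment> \<open>The divisor sum of 1 is 1, which is less than \<open>M + N\<close>.\<close>
  have "M \<noteq> 1" "N \<noteq> 1"
    using sigma pos by (auto simp: divisor_sum_def)
  then have "prime_factors M \<noteq> {}" "prime_factors N \<noteq> {}"
    using pos by (auto simp: prime_factorization_empty_iff)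
  then have ge: "card (prime_factors M) \<ge> 1" "card (prime_factors N) \<ge> 1"
    by (simp_all add: Suc_le_eq card_gt_0_iff)
  have card: "card P = card (prime_factors M) + card (prime_factors N)"
    using disjoint by (intro card_Un_disjoint) auto
  have "\<not> (card (prime_factors M) = 1 \<and> card (prime_factors N) = 1)"
  proof
    assume "card (prime_factors M) = 1 \<and> card (prime_factors N) = 1"
    then obtain p q where pq: "prime_factors M = {p}" "prime_factors N = {q}"
      by (auto simp: card_1_singleton_iff)
    \<comment> \<open>Both products are now single factors, each greater than 1/2.\<close>
    then have "E (\<lambda>_. 2) > 0"
      using c_less[of p] c_less[of q] by (simp add: E_def)
    then show False
      using E_full[of "\<lambda>_. 2"] by simp
  qed
  with ge card show ?thesis
    by linarith
qed

end

theorem theorem2: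
  fixes M N K :: nat
  assumes "amicable_pair M N"
    and "gcd M N = 1"
    and "K = num_prime_factors (M * N)"
  shows "real (M * N) < pi\<^sup>2 / 6 * 2 powi (4 ^ K - 2 * 2 ^ K)"
proof -
  interpret coprime_amicable_pair M N
    using assms by unfold_locales (auto simp: coprime_iff_gcd_eq_1)
  have "K = card P"
    using pos assms(3) by (simp add: num_prime_factors_def prime_factors_product)
  then obtain k where k: "K = Suc k" "k \<ge> 2"
    using card_P_ge_3 that[of "K - 1"] by auto
  have "2 * K = 2 * k + 2"
    using k by simp
  \<comment> \<open>Two iterates lead from 1 to 6. Starting the squaring estimate at 1 would only
    give \<open>2 ^ 4 ^ K\<close>, which is too large; starting at 6 gives base 7, below
    \<open>2 ^ 3\<close>.\<close>
  then have "(sylv ^^ (2 * K)) 1 = (sylv ^^ (2 * k)) 6"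
    by (simp only: funpow_add) (simp add: sylv_def numeral_2_eq_2)
  also have "\<dots> < 7 ^ 2 ^ (2 * k)"
    using sylv_funpow_le[of 6 "2 * k"] by simp
  also have "\<dots> = (7 :: real) ^ 4 ^ k"
    by (simp add: power_mult)
  also have "\<dots> \<le> (2 ^ 3) ^ 4 ^ k"
    by (intro power_mono) auto
  also have "\<dots> = 2 powi (3 * 4 ^ k)"
    using power_int_of_nat[of "2 :: real" "3 * 4 ^ k"] by (simp add: power_mult)
  also have "\<dots> \<le> 2 powi (4 ^ K - 2 * 2 ^ K)"
  proof (rule power_int_increasing)
    \<comment> \<open>In terms of \<open>k\<close> the goal is
      \<open>3 * 4 ^ k <= 4 * 4 ^ k - 4 * 2 ^ k\<close>, that is \<open>4 <= 2 ^ k\<close>; this is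
      where \<open>K >= 3\<close> enters.\<close>
    have "(2::int) ^ 2 \<le> 2 ^ k"
      using k by (intro power_increasing) auto
    then have "(4::int) * 2 ^ k \<le> 2 ^ k * 2 ^ k"
      by (intro mult_right_mono) auto
    also have "\<dots> = 4 ^ k"
      by (simp flip: power_mult_distrib)
    finally show "(3::int) * 4 ^ k \<le> 4 ^ K - 2 * 2 ^ K"
      using k by simp
  qed simp
  finally have "(sylv ^^ (2 * K)) 1 < 2 powi (4 ^ K - 2 * 2 ^ K)" .
  moreover have "real (M * N) \<le> real ((M + N)\<^sup>2)"
    unfolding of_nat_le_iff by (simp add: power2_eq_square algebra_simps)
  ultimately have "real (M * N) < 2 powi (4 ^ K - 2 * 2 ^ K)"
    using square_sum_le unfolding \<open>K = card P\<close> by linarith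
  also have "\<dots> \<le> pi\<^sup>2 / 6 * 2 powi (4 ^ K - 2 * 2 ^ K)"
  proof -
    have "3\<^sup>2 \<le> pi\<^sup>2"
      using pi_gt3 by (intro power_mono) auto
    then have "1 \<le> pi\<^sup>2 / 6"
      by simp
    then have "1 * 2 powi (4 ^ K - 2 * 2 ^ K) \<le> pi\<^sup>2 / 6 * 2 powi (4 ^ K - 2 * 2 ^ K)"
      by (rule mult_right_mono) simp
    then show ?thesis
      by simp
  qed
  finally show ?thesis .
qed

end
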